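(* Let $(L,\leq,0,1)$ be a bounded lattice. (1) Let $\top$ be a strongly separating locality relation on $L$. Then the assignment $\Psi^\top\colon L\to L$, $a\mapsto \operatorname{grt}(a^\top)$, is an orthocomplementation on $L$. (2) Conversely, given an orthocomplementation $\Psi$ on $L$, the relation $\top_\Psi$ on $L$ defined by $a\,\top_\Psi\, b \iff b\leq \Psi(a)$ is a strongly separating locality relation on $L$. (3) The maps $F\colon \{\text{strongly separating locality relations on } L\}\to\{\text{orthocomplementations on } L\}$, $\top\mapsto \Psi^\top$, and $G\colon \{\text{orthocomplementations on } L\}\to\{\text{strongly separating locality relations on } L\}$, $\Psi\mapsto \top_\Psi$, are inverse to each other.
   Context: Let $(L,\leq,\wedge,\vee)$ be a lattice with least element $0$ and greatest element $1$ (bounded lattice). For a subset $S\subseteq L$, $\operatorname{grt}(S)$ denotes the greatest element of $S$ (an element of $S$), if it exists. A poset ideal of $L$ is a subset $M\subseteq L$ such that $a\in M$ and $b\leq a$ imply $b\in M$. A lattice ideal is a poset ideal $M$ such that $a\vee b\in M$ for all $a,b\in M$. For a symmetric binary relation $\top$ on $L$ and $A\subseteq L$, the polar set is $A^\top:=\{x'\in L \mid x\,\top\, x' \text{ for all } x\in A\}$, and $a^\top:=\{a\}^\top$. A locality relation on the lattice $L$ is a symmetric binary relation $\top$ on $L$ such that $a^\top$ is a lattice ideal for every $a\in L$. A locality relation $\top$ on the bounded lattice $L$ is separating if (a) $a\,\top\, b\Rightarrow a\wedge b=0$ for all $a,b\in L$, and (b) $a^\top$ admits a greatest element $\operatorname{grt}(a^\top)$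 for every $a\in L$. It is strongly separating if it is separating and moreover (c) $\operatorname{grt}((a^\top)^\top)=a$ for every $a\in L$. An orthocomplementation on $L$ is a map $\Psi\colon L\to L$ such that: (antitone) $b\leq a\Rightarrow \Psi(a)\leq\Psi(b)$ for all $a,b\in L$; (involutive) $\Psi\circ\Psi=\mathrm{Id}$; (separating) for all $a,b\in L$, if $b\leq a$ and $b\leq\Psi(a)$ then $b=0$. *)

theory Defs
  imports Main "HOL-Library.FuncSet"
begin

definition is_grt :: "'a::order set \<Rightarrow> 'a \<Rightarrow> bool" where
  "is_grt S g \<longleftrightarrow> g \<in> S \<and> (\<forall>x\<in>S. x \<le> g)"

text \<open>Only meaningful when a greatest element exists; \<^term>\<open>GREATEST x. P x\<close> is unspecified otherwise.\<close>

definition grt :: "'a::order set \<Rightarrow> 'a" where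
  "grt S = (GREATEST x. x \<in> S)"

definition poset_ideal :: "'a::order set \<Rightarrow> bool" where
  "poset_ideal M \<longleftrightarrow> (\<forall>a b. a \<in> M \<longrightarrow> b \<le> a \<longrightarrow> b \<in> M)"

text \<open>As for poset ideals, nonemptiness is not part of the definition.\<close>

definition lattice_ideal :: "'a::lattice set \<Rightarrow> bool" where
  "lattice_ideal M \<longleftrightarrow> poset_ideal M \<and> (\<forall>a\<in>M. \<forall>b\<in>M. sup a b \<in> M)"

definition polar :: "('a \<Rightarrow> 'a \<Rightarrow> bool) \<Rightarrow> 'a set \<Rightarrow> 'a set" where
  "polar T A = {x'. \<forall>x\<in>A. T x x'}"

definition locality_relation :: "('a::lattice \<Rightarrow> 'a \<Rightarrow> bool) \<Rightarrow> bool" where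
  "locality_relation T \<longleftrightarrow> symp T \<and> (\<forall>a. lattice_ideal (polar T {a}))"

definition separating :: "('a::bounded_lattice \<Rightarrow> 'a \<Rightarrow> bool) \<Rightarrow> bool" where
  "separating T \<longleftrightarrow> locality_relation T \<and>
     (\<forall>a b. T a b \<longrightarrow> inf a b = bot) \<and>
     (\<forall>a. \<exists>g. is_grt (polar T {a}) g)"

text \<open>The last clause asserts both that the greatest element of the double polar exists and that
  it equals \<open>a\<close>; an equation using \<^const>\<open>grt\<close> alone would not ensure existence.\<close>

definition strongly_separating :: "('a::bounded_lattice \<Rightarrow> 'a \<Rightarrow> bool) \<Rightarrow> bool" where
  "strongly_separating T \<longleftrightarrow> separating T \<and> (\<forall>a. is_grt (polar T (polar T {a})) a)"

definition orthocomplementation :: "('a::bounded_lattice \<Rightarrow> 'a) \<Rightarrow> bool" where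
  "orthocomplementation \<Psi> \<longleftrightarrow> antimono \<Psi> \<and> \<Psi> \<circ> \<Psi> = id \<and>
     (\<forall>a b. b \<le> a \<longrightarrow> b \<le> \<Psi> a \<longrightarrow> b = bot)"

definition ortho_of_rel :: "('a::bounded_lattice \<Rightarrow> 'a \<Rightarrow> bool) \<Rightarrow> 'a \<Rightarrow> 'a" where
  "ortho_of_rel T = (\<lambda>a. grt (polar T {a}))"

definition rel_of_ortho :: "('a::bounded_lattice \<Rightarrow> 'a) \<Rightarrow> 'a \<Rightarrow> 'a \<Rightarrow> bool" where
  "rel_of_ortho \<Psi> = (\<lambda>a b. b \<le> \<Psi> a)"

end

theory Submission
  imports Defs
begin

text \<open>
  Both structures are two descriptions of one thing: a symmetric relation whose polars are the
  principal ideals of a map \<open>\<Psi>\<close>, that is, \<open>T a b \<longleftrightarrow> b \<le> \<Psi> a\<close> (an antitone Galois connection of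
  \<open>L\<close> with itself). If \<open>a\<^sup>\<top>\<close> is a down-set with greatest element \<open>\<Psi> a\<close>, it equals
  \<open>{..\<Psi> a}\<close>, so \<open>T\<close> is recovered from \<open>\<Psi>\<close>
  (\<open>rel_of_ortho_ortho_of_rel\<close>); conversely the greatest element of \<open>{..\<Psi> a}\<close> is \<open>\<Psi> a\<close>
  (\<open>ortho_of_rel_rel_of_ortho\<close>). Hence the two assignments are inverse to each other for almost
  formal reasons, and what remains is to match the axioms.

  Symmetry of \<open>T\<close> makes the double polar of \<open>a\<close> the principal ideal of \<open>\<Psi> (\<Psi> a)\<close>
  (\<open>double_polar_rel_of_ortho\<close>), so the condition that its greatest element is \<open>a\<close> says exactly
  that \<open>\<Psi>\<close> is involutive. The condition \<open>a \<and> b = 0\<close> for related \<open>a\<close> and \<open>b\<close> corresponds to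
  the separating axiom of \<open>\<Psi>\<close>. Antitonicity of \<open>\<Psi>\<close> comes from symmetry of \<open>T\<close>
  together with the fact that polars are down-sets; for involutive \<open>\<Psi>\<close> antitonicity gives
  symmetry back.
\<close>

lemma is_grt_atMost_iff: "is_grt {..c} g \<longleftrightarrow> g = c"
  by (auto simp: is_grt_def intro: order_antisym)

lemma grt_eqI: "is_grt S g \<Longrightarrow> grt S = g"
  unfolding is_grt_def grt_def by (intro Greatest_equality) auto

lemma lattice_ideal_atMost: "lattice_ideal {..c :: 'a::lattice}"
  by (auto simp: lattice_ideal_def poset_ideal_def intro: order_trans)

lemma poset_ideal_eq_atMost:
  assumes "poset_ideal M" and "is_grt M g"
  shows "M = {..g}"
  using assms unfolding poset_ideal_def is_grt_def by blast

lemma polar_rel_of_ortho: "polar (rel_of_ortho \<Psi>) {a} = {..\<Psi> a}"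
  by (auto simp: polar_def rel_of_ortho_def)

text \<open>
  An element related to \<open>\<Psi> a\<close> is, by symmetry, one whose polar contains \<open>\<Psi> a\<close>; that polar is a
  down-set, so it contains all of \<open>{..\<Psi> a}\<close>. Hence \<open>{..\<Psi> a}\<close> has the same polar as its top
  element.
\<close>

lemma double_polar_rel_of_ortho:
  assumes "symp (rel_of_ortho \<Psi>)"
  shows "polar (rel_of_ortho \<Psi>) (polar (rel_of_ortho \<Psi>) {a}) = {..\<Psi> (\<Psi> a)}"
proof -
  have "y \<le> \<Psi> x" if "y \<le> \<Psi> (\<Psi> a)" and "x \<le> \<Psi> a" for x y
  proof -
    have "\<Psi> a \<le> \<Psi> y"
      using sympD[OF assms] that(1) unfolding rel_of_ortho_def by blast
    with that(2) have "x \<le> \<Psi> y" by (rule order_trans)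
    then show "y \<le> \<Psi> x"
      using sympD[OF assms] unfolding rel_of_ortho_def by blast
  qed
  then show ?thesis
    unfolding polar_rel_of_ortho by (auto simp: polar_def rel_of_ortho_def)
qed

lemma ortho_of_rel_rel_of_ortho: "ortho_of_rel (rel_of_ortho \<Psi>) = \<Psi>"
  unfolding ortho_of_rel_def polar_rel_of_ortho
  by (simp add: grt_eqI is_grt_atMost_iff)

lemma rel_of_ortho_ortho_of_rel:
  assumes "separating T"
  shows "rel_of_ortho (ortho_of_rel T) = T"
proof (intro ext)
  fix a b
  from assms obtain g where g: "is_grt (polar T {a}) g"
    unfolding separating_def by blast
  have "poset_ideal (polar T {a})"
    using assms by (simp add: separating_def locality_relation_def lattice_ideal_def)
  then have "polar T {a} = {..ortho_of_rel T a}"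
    using poset_ideal_eq_atMost[OF _ g] grt_eqI[OF g] by (simp add: ortho_of_rel_def)
  then show "rel_of_ortho (ortho_of_rel T) a b = T a b"
    unfolding rel_of_ortho_def polar_def by auto
qed

text \<open>
  Apart from symmetry and disjointness, the clauses speak of polars only, and these are principal
  ideals: being a lattice ideal with a greatest element is automatic for them, and the greatest
  element of the double polar turns its clause into involutivity.
\<close>

lemma strongly_separating_rel_of_ortho_iff:
  "strongly_separating (rel_of_ortho \<Psi>) \<longleftrightarrow>
     symp (rel_of_ortho \<Psi>) \<and> (\<forall>a b. b \<le> \<Psi> a \<longrightarrow> inf a b = bot) \<and> (\<forall>a. \<Psi> (\<Psi> a) = a)"
proof (cases "symp (rel_of_ortho \<Psi>)")
  case True
  have "is_grt (polar (rel_of_ortho \<Psi>) (polar (rel_of_ortho \<Psi>) {a})) a \<longleftrightarrow> \<Psi> (\<Psi> a) = a" for a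
    unfolding double_polar_rel_of_ortho[OF True] is_grt_atMost_iff by (rule eq_commute)
  moreover
  have "\<exists>g. is_grt {..\<Psi> a} g" for a
    unfolding is_grt_atMost_iff by blast
  then have "separating (rel_of_ortho \<Psi>) \<longleftrightarrow> (\<forall>a b. b \<le> \<Psi> a \<longrightarrow> inf a b = bot)"
    using True unfolding separating_def locality_relation_def polar_rel_of_ortho
    by (simp add: lattice_ideal_atMost rel_of_ortho_def)
  ultimately show ?thesis
    using True by (simp add: strongly_separating_def)
next
  case False
  then show ?thesis
    by (simp add: strongly_separating_def separating_def locality_relation_def)
qed

text \<open>
  Symmetry says that \<open>b \<le> \<Psi> a\<close> implies \<open>a \<le> \<Psi> b\<close>. As \<open>\<Psi>\<close> is an involution, every element has
  the form \<open>\<Psi> a\<close>, and substituting \<open>\<Psi> a\<close> for \<open>a\<close> gives antitonicity: \<open>b \<le> a\<close> implies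
  \<open>\<Psi> a \<le> \<Psi> b\<close>.
\<close>

lemma symp_rel_of_ortho_iff_antimono:
  assumes invol: "\<And>a. \<Psi> (\<Psi> a) = a"
  shows "symp (rel_of_ortho \<Psi>) \<longleftrightarrow> antimono \<Psi>"
proof
  assume sym: "symp (rel_of_ortho \<Psi>)"
  show "antimono \<Psi>"
  proof (rule antimonoI)
    fix b a :: 'a
    assume "b \<le> a"
    then have "rel_of_ortho \<Psi> (\<Psi> a) b"
      by (simp add: rel_of_ortho_def invol)
    then show "\<Psi> a \<le> \<Psi> b"
      using sympD[OF sym] unfolding rel_of_ortho_def by blast
  qed
next
  assume anti: "antimono \<Psi>"
  show "symp (rel_of_ortho \<Psi>)"
  proof (rule sympI)
    fix a b
    assume "rel_of_ortho \<Psi> a b"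
    then have "\<Psi> (\<Psi> a) \<le> \<Psi> b"
      using antimonoD[OF anti] unfolding rel_of_ortho_def by blast
    then show "rel_of_ortho \<Psi> b a"
      by (simp add: rel_of_ortho_def invol)
  qed
qed

lemma inf_eq_bot_iff_separating_map:
  fixes \<Psi> :: "'a::bounded_lattice \<Rightarrow> 'a"
  shows "(\<forall>a b. b \<le> \<Psi> a \<longrightarrow> inf a b = bot) \<longleftrightarrow> (\<forall>a b. b \<le> a \<longrightarrow> b \<le> \<Psi> a \<longrightarrow> b = bot)"
proof (intro iffI allI impI)
  fix a c
  assume "\<forall>a b. b \<le> \<Psi> a \<longrightarrow> inf a b = bot" and "c \<le> a" and "c \<le> \<Psi> a"
  then have "inf a c = bot" by blast
  with \<open>c \<le> a\<close> show "c = bot" by (simp add: inf.absorb2)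
next
  fix a b
  assume sep: "\<forall>a b. b \<le> a \<longrightarrow> b \<le> \<Psi> a \<longrightarrow> b = bot" and "b \<le> \<Psi> a"
  then have "inf a b \<le> \<Psi> a" by (simp add: le_infI2)
  then show "inf a b = bot" by (rule sep[rule_format, OF inf_le1])
qed

lemma strongly_separating_iff_orthocomplementation:
  "strongly_separating (rel_of_ortho \<Psi>) \<longleftrightarrow> orthocomplementation \<Psi>"
proof (cases "\<forall>a. \<Psi> (\<Psi> a) = a")
  case True
  then have "symp (rel_of_ortho \<Psi>) \<longleftrightarrow> antimono \<Psi>"
    by (intro symp_rel_of_ortho_iff_antimono) (rule spec)
  with True show ?thesis
    unfolding strongly_separating_rel_of_ortho_iff orthocomplementation_def
      inf_eq_bot_iff_separating_map fun_eq_iff comp_apply id_apply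
    by argo
next
  case False
  then show ?thesis
    unfolding strongly_separating_rel_of_ortho_iff orthocomplementation_def
      fun_eq_iff comp_apply id_apply
    by argo
qed

lemma rel_of_ortho_ortho_of_rel_strongly_separating:
  "strongly_separating T \<Longrightarrow> rel_of_ortho (ortho_of_rel T) = T"
  by (simp add: strongly_separating_def rel_of_ortho_ortho_of_rel)

lemma orthocomplementation_ortho_of_rel:
  "strongly_separating T \<Longrightarrow> orthocomplementation (ortho_of_rel T)"
  using strongly_separating_iff_orthocomplementation[of "ortho_of_rel T"]
  by (simp only: rel_of_ortho_ortho_of_rel_strongly_separating)

theorem theorem5p16:
  shows "(\<forall>T :: 'a::bounded_lattice \<Rightarrow> 'a \<Rightarrow> bool.
            strongly_separating T \<longrightarrow> orthocomplementation (ortho_of_rel T)) \<and>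
         (\<forall>\<Psi> :: 'a \<Rightarrow> 'a.
            orthocomplementation \<Psi> \<longrightarrow> strongly_separating (rel_of_ortho \<Psi>)) \<and>
         (ortho_of_rel \<in> {T :: 'a \<Rightarrow> 'a \<Rightarrow> bool. strongly_separating T}
                           \<rightarrow> {\<Psi> :: 'a \<Rightarrow> 'a. orthocomplementation \<Psi>} \<and>
          rel_of_ortho \<in> {\<Psi> :: 'a \<Rightarrow> 'a. orthocomplementation \<Psi>}
                           \<rightarrow> {T :: 'a \<Rightarrow> 'a \<Rightarrow> bool. strongly_separating T} \<and>
          (\<forall>T :: 'a \<Rightarrow> 'a \<Rightarrow> bool. strongly_separating T \<longrightarrow> rel_of_ortho (ortho_of_rel T) = T) \<and>
          (\<forall>\<Psi> :: 'a \<Rightarrow> 'a. orthocomplementation \<Psi> \<longrightarrow> ortho_of_rel (rel_of_ortho \<Psi>) = \<Psi>))"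
  by (intro conjI allI impI Pi_I CollectI)
    (auto simp only: mem_Collect_eq orthocomplementation_ortho_of_rel
      strongly_separating_iff_orthocomplementation
      rel_of_ortho_ortho_of_rel_strongly_separating ortho_of_rel_rel_of_ortho)

end
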